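(* Let $n\geq 5$ and let $\mathrm{GCA}(m)$, $m\geq 3$, be the lists of involutions of $\mathcal{S}_m$ defined below. If $\mathrm{GCA}(n-2)$ and $\mathrm{GCA}(n-1)$ each contain every involution of $\mathcal{S}_{n-2}$, resp. $\mathcal{S}_{n-1}$, exactly once and satisfy properties A1 and A2, then $\mathrm{GCA}(n)$ contains every involution of $\mathcal{S}_n$ exactly once, satisfies properties A1 and A2, and is cyclic (its first element is also obtained from its last element in the manner described in A2).
   Context: Permutations are written in one-line notation or in cycle notation; $\mathrm{id}$ is the identity. An involution over an alphabet $N$ of positive integers is an involutive permutation of $N$, written in one-line notation with positions indexed by $N$ in increasing order. List operations. For a list $L=(w_1,\dots,w_m)$ of involutions over $N$: $\overleftarrow{L}=(w_m,\dots,w_1)$; for $k\notin N$, $L\cdot k$ extends each $w_\ell$ to $N\cup\{k\}$ fixing $k$; for $i,j\notin N$, $L\cdot(i\,j)=(w_1(i\,j),\dots,w_m(i\,j))$, each $w_\ell$ composed with the disjoint transposition $(i\,j)$ over $N\cup\{i,j\}$. For an alphabet $N=\{a_1,\dots,a_r\}$ and bijection $F:[r]\to N$, $F(i)=a_i$, written $F=a_1a_2\cdots a_r$, and an involution $w$ of $[r]$, $w^F$ is the involution of $N$ with $w^F(F(i))=F(w(i))$ (so $(x\,y)\mapsto(a_x\,a_y)$); $L^F=(w_1^F,\dots,w_m^F)$, and $\overleftarrow{L}^F$ denotes the reversal of $L^F$. Concatenation of lists is written by juxtaposition. The lists $\mathrm{GCA}(m)$: $\mathrm{GCA}(3)=(\mathrm{id},(1\,2),(1\,3),(2\,3))$;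 $\mathrm{GCA}(4)=(\mathrm{id},(1\,3),(1\,3)(2\,4),(2\,4),(1\,4),(1\,4)(2\,3),(2\,3),(1\,2),(1\,2)(3\,4),(3\,4))$. For odd $n\geq5$: $\mathrm{GCA}(n)$ is the concatenation of $\mathrm{GCA}(n-1)^{F_0}\cdot n$ with $F_0=2\,3\cdots(n-1)\,1$, followed, for $i=1,2,\dots,\frac{n-1}{2}$ in order, by $\mathrm{GCA}(n-2)^{G_i}\cdot(2i-1\;n)$ and then $\overleftarrow{\mathrm{GCA}}(n-2)^{H_i}\cdot(2i\;n)$, where $G_i=(2i)\,1\,2\cdots(2i-2)\,(2i+1)\cdots(n-1)$ and $H_i=(2i-1)\,1\,2\cdots(2i-2)\,(2i+1)\cdots(n-1)$. For even $n\geq6$: $\mathrm{GCA}(n)$ is the concatenation of $\mathrm{GCA}(n-1)\cdot n$, then $\overleftarrow{\mathrm{GCA}}(n-2)^{F}\cdot(1\;n)$ with $F=2\,3\cdots(n-1)$, then, for $i=1,\dots,\frac n2-1$ in order, $\mathrm{GCA}(n-2)^{G_i}\cdot(2i\;n)$ followed by $\overleftarrow{\mathrm{GCA}}(n-2)^{H_i}\cdot(2i+1\;n)$, where $G_i=(2i+1)\,1\,2\cdots(2i-1)\,(2i+2)\cdots(n-1)$ and $H_i=(2i)\,1\,2\cdots(2i-1)\,(2i+2)\cdots(n-1)$. Property A1 (for a list of involutions of $[n]$): the first element is $\mathrm{id}$ and the last is $(n-1\;n)$. Property A2: each element is obtained from its predecessor, in one-line notation, either by exchanging the entries in two positions or by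 cyclically rotating the entries in three positions. *)

theory Defs
  imports "HOL-Combinatorics.Permutations"
begin

(* A permutation of an alphabet N of positive integers is encoded, as in the library, by a function
   on nat that fixes every point outside N; the entry of its one-line notation in position x (for x
   in N) is w x.  As a function, the extension of w to a larger alphabet by fixed points is w itself. *)

definition involutions :: "nat set \<Rightarrow> (nat \<Rightarrow> nat) set" where
  "involutions N = {w. w permutes N \<and> w \<circ> w = id}"

(* L . k  (k outside the alphabet of L) *)
definition append_fixed :: "nat \<Rightarrow> (nat \<Rightarrow> nat) list \<Rightarrow> (nat \<Rightarrow> nat) list" where
  "append_fixed k L = map (\<lambda>w. w(k := k)) L"

(* L . (i j)  (i, j outside the alphabet of L) *)
definition append_swap :: "nat \<Rightarrow> nat \<Rightarrow> (nat \<Rightarrow> nat) list \<Rightarrow> (nat \<Rightarrow> nat) list" where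
  "append_swap i j L = map (\<lambda>w. w \<circ> transpose i j) L"

(* The word F = a_1 ... a_r, a list with distinct entries, read as the bijection i |-> a_i from [r]
   onto set F. *)
definition word_fun :: "nat list \<Rightarrow> nat \<Rightarrow> nat" where
  "word_fun F i = F ! (i - 1)"

(* w^F, the involution of set F with w^F (F i) = F (w i) *)
definition relabel :: "nat list \<Rightarrow> (nat \<Rightarrow> nat) \<Rightarrow> nat \<Rightarrow> nat" where
  "relabel F w x =
     (if x \<in> set F then word_fun F (w (inv_into {1..length F} (word_fun F) x)) else x)"

definition relabel_list :: "nat list \<Rightarrow> (nat \<Rightarrow> nat) list \<Rightarrow> (nat \<Rightarrow> nat) list" where
  "relabel_list F L = map (relabel F) L"

(* GCA n is meant for n \<ge> 3; the value [] below 3 is a dummy. *)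
function GCA :: "nat \<Rightarrow> (nat \<Rightarrow> nat) list" where
  "GCA n =
    (if n < 3 then []
     else if n = 3 then [id, transpose 1 2, transpose 1 3, transpose 2 3]
     else if n = 4 then
       [id,
        transpose 1 3, transpose 1 3 \<circ> transpose 2 4, transpose 2 4,
        transpose 1 4, transpose 1 4 \<circ> transpose 2 3, transpose 2 3,
        transpose 1 2, transpose 1 2 \<circ> transpose 3 4, transpose 3 4]
     else if odd n then
       append_fixed n (relabel_list ([2..<n] @ [1]) (GCA (n - 1))) @
       concat (map (\<lambda>i.
           append_swap (2*i - 1) n
             (relabel_list ([2*i] @ [1..<2*i - 1] @ [2*i + 1..<n]) (GCA (n - 2))) @
           append_swap (2*i) n
             (rev (relabel_list ([2*i - 1] @ [1..<2*i - 1] @ [2*i + 1..<n]) (GCA (n - 2)))))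
         [1..<(n - 1) div 2 + 1])
     else
       append_fixed n (GCA (n - 1)) @
       append_swap 1 n (rev (relabel_list [2..<n] (GCA (n - 2)))) @
       concat (map (\<lambda>i.
           append_swap (2*i) n
             (relabel_list ([2*i + 1] @ [1..<2*i] @ [2*i + 2..<n]) (GCA (n - 2))) @
           append_swap (2*i + 1) n
             (rev (relabel_list ([2*i] @ [1..<2*i] @ [2*i + 2..<n]) (GCA (n - 2)))))
         [1..<n div 2]))"
  by pat_completeness auto
termination by (relation "measure id") auto

declare GCA.simps [simp del]

definition lists_involutions_once :: "nat \<Rightarrow> (nat \<Rightarrow> nat) list \<Rightarrow> bool" where
  "lists_involutions_once n L \<longleftrightarrow> distinct L \<and> set L = involutions {1..n}"

(* v arises from u, in one-line notation over [n], by exchanging the entries in two positions or by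
   cyclically rotating the entries in three positions.  Both directions of rotation are covered, as
   i, j, k are in arbitrary order. *)
definition gray_step :: "nat \<Rightarrow> (nat \<Rightarrow> nat) \<Rightarrow> (nat \<Rightarrow> nat) \<Rightarrow> bool" where
  "gray_step n u v \<longleftrightarrow>
     (\<exists>i\<in>{1..n}. \<exists>j\<in>{1..n}. i \<noteq> j \<and> v = u(i := u j, j := u i)) \<or>
     (\<exists>i\<in>{1..n}. \<exists>j\<in>{1..n}. \<exists>k\<in>{1..n}.
        distinct [i, j, k] \<and> v = u(i := u j, j := u k, k := u i))"

definition property_A1 :: "nat \<Rightarrow> (nat \<Rightarrow> nat) list \<Rightarrow> bool" where
  "property_A1 n L \<longleftrightarrow> L \<noteq> [] \<and> hd L = id \<and> last L = transpose (n - 1) n"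

definition property_A2 :: "nat \<Rightarrow> (nat \<Rightarrow> nat) list \<Rightarrow> bool" where
  "property_A2 n L \<longleftrightarrow> (\<forall>l. Suc l < length L \<longrightarrow> gray_step n (L ! l) (L ! Suc l))"

definition cyclic_list :: "nat \<Rightarrow> (nat \<Rightarrow> nat) list \<Rightarrow> bool" where
  "cyclic_list n L \<longleftrightarrow> L \<noteq> [] \<and> gray_step n (last L) (hd L)"

end

theory Submission
  imports Defs
begin

text \<open>Classify the involutions w of [n] by the value w n. Those with w n = n are the involutions of
  [n - 1], and those with w n = j < n are the products (j n) v with v an involution of [n - 1] - {j};
  so each class is listed by a relabelled copy of a shorter code. A Gray step multiplies on the
  right by a transposition or a 3-cycle, hence survives relabelling, reversal and multiplication by
  a disjoint transposition. The words are chosen such that the blocks for j and j + 1 meet in two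
  involutions of the form v (j n) and v (j + 1 n), which differ by a 3-cycle.\<close>

section \<open>Gray steps as right multiplications\<close>

text \<open>The composition \<open>transpose i j \<circ> transpose j k\<close> is the 3-cycle
  sending i to j, j to k and k to i. The order of i, j, k is free, so its inverse is covered
  too.\<close>

definition short_cycle :: "'a set \<Rightarrow> ('a \<Rightarrow> 'a) \<Rightarrow> bool" where
  "short_cycle N c \<longleftrightarrow>
     (\<exists>i\<in>N. \<exists>j\<in>N. i \<noteq> j \<and> c = transpose i j) \<or>
     (\<exists>i\<in>N. \<exists>j\<in>N. \<exists>k\<in>N. distinct [i, j, k] \<and> c = transpose i j \<circ> transpose j k)"

text \<open>Right multiplication acts on positions, so this is a Gray step. The alphabet is
  arbitrary because the blocks are codes over sets such as [n - 1] - {j}.\<close>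

definition gray_on :: "'a set \<Rightarrow> ('a \<Rightarrow> 'a) \<Rightarrow> ('a \<Rightarrow> 'a) \<Rightarrow> bool" where
  "gray_on N u v \<longleftrightarrow> (\<exists>c. short_cycle N c \<and> v = u \<circ> c)"

lemma gray_step_iff_gray_on: "gray_step n u v \<longleftrightarrow> gray_on {1..n} u v"
proof -
  have 1: "u(i := u j, j := u i) = u \<circ> transpose i j" if "i \<noteq> j" for i j
    using that by (auto simp: fun_eq_iff transpose_def)
  have 2: "u(i := u j, j := u k, k := u i) = u \<circ> (transpose i j \<circ> transpose j k)"
    if "distinct [i, j, k]" for i j k
    using that by (auto simp: fun_eq_iff transpose_def)
  show ?thesis
  proof
    assume "gray_step n u v"
    then show "gray_on {1..n} u v"
      unfolding gray_step_def gray_on_def short_cycle_def by (elim disjE bexE conjE) (use 1 2 in blast)+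
  next
    assume "gray_on {1..n} u v"
    then obtain c where "short_cycle {1..n} c" and v: "v = u \<circ> c"
      unfolding gray_on_def by blast
    then show "gray_step n u v"
      unfolding short_cycle_def gray_step_def v by (elim disjE bexE conjE) (use 1 2 in metis)+
  qed
qed

lemma short_cycle_permutes: "short_cycle N c \<Longrightarrow> c permutes N"
  unfolding short_cycle_def by (auto intro: permutes_swap_id permutes_compose)

lemma short_cycle_mono: "short_cycle N c \<Longrightarrow> N \<subseteq> M \<Longrightarrow> short_cycle M c"
  unfolding short_cycle_def by blast

lemma short_cycle_right_inverse:
  assumes "short_cycle N c"
  obtains d where "short_cycle N d" "c \<circ> d = id"
proof -
  consider i j where "i \<in> N" "j \<in> N" "i \<noteq> j" "c = transpose i j"
    | i j k where "i \<in> N" "j \<in> N" "k \<in> N" "distinct [i, j, k]" "c = transpose i j \<circ> transpose j k"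
    using assms unfolding short_cycle_def by blast
  then show ?thesis
  proof cases
    case 1
    then show ?thesis using assms that[of c] by simp
  next
    case 2
    have "short_cycle N (transpose k j \<circ> transpose j i)"
      using 2 unfolding short_cycle_def by (metis distinct_length_2_or_more)
    moreover have "c \<circ> (transpose k j \<circ> transpose j i) = id"
      using 2 by (auto simp: fun_eq_iff transpose_commute)
    ultimately show ?thesis using that by blast
  qed
qed

text \<open>Relabelling is conjugation, which keeps the cycle type. The 3-cycle is handled through
  its two factors, since \<open>map_permutation\<close> is multiplicative.\<close>

lemma short_cycle_map_permutation:
  assumes "short_cycle N c" "inj_on f N"
  shows "short_cycle (f ` N) (map_permutation N f c)"
proof -
  consider i j where "i \<in> N" "j \<in> N" "i \<noteq> j" "c = transpose i j"
    | i j k where "i \<in> N" "j \<in> N" "k \<in> N" "distinct [i, j, k]" "c = transpose i j \<circ> transpose j k"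
    using assms unfolding short_cycle_def by blast
  then show ?thesis
  proof cases
    case 1
    then have "f i \<noteq> f j" using assms(2) by (auto dest: inj_onD)
    with 1 show ?thesis using assms(2)
      unfolding short_cycle_def by (auto simp: map_permutation_transpose)
  next
    case 2
    have "distinct [f i, f j, f k]" using 2 assms(2) by (auto dest: inj_onD)
    moreover have "map_permutation N f c = transpose (f i) (f j) \<circ> transpose (f j) (f k)"
      using 2 assms(2)
      by (simp add: map_permutation_compose' map_permutation_transpose permutes_swap_id)
    ultimately show ?thesis
      using 2 unfolding short_cycle_def by blast
  qed
qed

lemma gray_on_sym:
  assumes "gray_on N u v"
  shows "gray_on N v u"
proof -
  obtain c where c: "short_cycle N c" "v = u \<circ> c"
    using assms unfolding gray_on_def by blast
  obtain d where "short_cycle N d" "c \<circ> d = id"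
    using short_cycle_right_inverse[OF c(1)] .
  then show ?thesis
    using c(2) unfolding gray_on_def by (metis comp_assoc comp_id)
qed

lemma gray_on_mono: "gray_on N u v \<Longrightarrow> N \<subseteq> M \<Longrightarrow> gray_on M u v"
  unfolding gray_on_def using short_cycle_mono by blast

lemma gray_on_comp_transpose: "i \<in> N \<Longrightarrow> j \<in> N \<Longrightarrow> i \<noteq> j \<Longrightarrow> gray_on N u (u \<circ> transpose i j)"
  unfolding gray_on_def short_cycle_def by blast

text \<open>Used wherever one block ends and the next begins with the same factor u and a changed
  partner of k: solving u (j k) = u (i k) c gives c = (i k)(k j), a 3-cycle.\<close>

lemma gray_on_exchange_partner:
  assumes "i \<in> N" "j \<in> N" "k \<in> N" "distinct [i, j, k]"
  shows "gray_on N (u \<circ> transpose i k) (u \<circ> transpose j k)"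
proof -
  have "short_cycle N (transpose i k \<circ> transpose k j)"
    using assms unfolding short_cycle_def by (metis distinct_length_2_or_more)
  moreover have "u \<circ> transpose j k = u \<circ> transpose i k \<circ> (transpose i k \<circ> transpose k j)"
    by (simp add: fun_eq_iff transpose_commute)
  ultimately show ?thesis unfolding gray_on_def by blast
qed

lemma permutes_commute_transpose:
  assumes "w permutes N" "i \<notin> N" "k \<notin> N"
  shows "w \<circ> transpose i k = transpose i k \<circ> w"
proof -
  have "inv w i = i" "inv w k = k"
    using permutes_inv[OF assms(1)] assms(2,3) by (auto simp: permutes_not_in)
  then show ?thesis
    using transpose_comp_eq[OF permutes_bij[OF assms(1)], of i k] by simp
qed

text \<open>As c moves only points of N, it commutes with (i k), so u c (i k) = u (i k) c: the very
  same c serves as the step.\<close>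

lemma gray_on_comp_disjoint_transpose:
  assumes "gray_on N u v" "i \<notin> N" "k \<notin> N"
  shows "gray_on N (u \<circ> transpose i k) (v \<circ> transpose i k)"
proof -
  obtain c where c: "short_cycle N c" "v = u \<circ> c"
    using assms(1) unfolding gray_on_def by blast
  have "v \<circ> transpose i k = u \<circ> transpose i k \<circ> c"
    using permutes_commute_transpose[OF short_cycle_permutes[OF c(1)] assms(2,3)] c(2)
    by (simp add: comp_assoc)
  then show ?thesis using c(1) unfolding gray_on_def by blast
qed

section \<open>Gray codes of involutions over an alphabet\<close>

text \<open>A1 is kept apart: relabelling and reversal preserve what is stated here but change the
  end elements.\<close>

definition gray_code :: "nat set \<Rightarrow> (nat \<Rightarrow> nat) list \<Rightarrow> bool" where
  "gray_code N L \<longleftrightarrow> distinct L \<and> set L = involutions N \<and> successively (gray_on N) L"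

lemma property_A2_iff: "property_A2 n L \<longleftrightarrow> successively (gray_on {1..n}) L"
  unfolding property_A2_def successively_conv_nth gray_step_iff_gray_on ..

lemma gray_code_atLeastAtMost_iff:
  "gray_code {1..n} L \<longleftrightarrow> lists_involutions_once n L \<and> property_A2 n L"
  unfolding gray_code_def lists_involutions_once_def property_A2_iff by blast

lemma gray_code_rev: "gray_code N L \<Longrightarrow> gray_code N (rev L)"
  unfolding gray_code_def by (auto elim!: successively_mono intro: gray_on_sym)

section \<open>Relabelling along a word\<close>

lemma bij_betw_word_fun:
  assumes "distinct F"
  shows "bij_betw (word_fun F) {1..length F} (set F)"
proof -
  have "bij_betw (\<lambda>i. i - 1) {1..length F} {..<length F}"
    by (rule bij_betwI[where g = Suc]) auto
  then have "bij_betw ((!) F \<circ> (\<lambda>i. i - 1)) {1..length F} (set F)"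
    using bij_betw_nth[OF assms refl refl] by (rule bij_betw_trans)
  then show ?thesis by (simp add: word_fun_def[abs_def] comp_def)
qed

lemma relabel_eq_map_permutation:
  assumes "distinct F"
  shows "relabel F w = map_permutation {1..length F} (word_fun F) w"
  using bij_betw_imp_surj_on[OF bij_betw_word_fun[OF assms]]
  by (auto simp: fun_eq_iff relabel_def map_permutation_def restrict_id_def)

text \<open>Conjugation by f is multiplicative and so preserves w w = id; conjugation by the inverse
  of f undoes it.\<close>

lemma bij_betw_map_permutation_involutions:
  assumes f: "bij_betw f N M"
  shows "bij_betw (map_permutation N f) (involutions N) (involutions M)"
proof (rule bij_betwI[where g = "map_permutation M (inv_into N f)"])
  have inv: "map_permutation A h w \<in> involutions B"
    if "bij_betw h A B" "w \<in> involutions A" for h and A B :: "nat set" and w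
  proof -
    have w: "w permutes A" "w \<circ> w = id" and h: "inj_on h A"
      using that by (auto simp: involutions_def bij_betw_def)
    have "map_permutation A h w \<circ> map_permutation A h w = id"
      using map_permutation_compose'[OF h w(1), of w] w(2) by (simp add: map_permutation_id'[OF h])
    then show ?thesis
      using map_permutation_permutes[OF that(1) w(1)] by (simp add: involutions_def)
  qed
  have g: "bij_betw (inv_into N f) M N" using f by (rule bij_betw_inv_into)
  show "map_permutation N f \<in> involutions N \<rightarrow> involutions M" using inv[OF f] by blast
  show "map_permutation M (inv_into N f) \<in> involutions M \<rightarrow> involutions N" using inv[OF g] by blast
  show "map_permutation M (inv_into N f) (map_permutation N f w) = w" if "w \<in> involutions N" for w
    using that f by (intro map_permutation_compose_inv)
      (auto simp: involutions_def bij_betw_def inv_into_f_f)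
  show "map_permutation N f (map_permutation M (inv_into N f) w) = w" if "w \<in> involutions M" for w
    using that g f by (intro map_permutation_compose_inv)
      (auto simp: involutions_def bij_betw_inv_into_right)
qed

text \<open>A step from u to u c becomes a step from the relabelled u to its product with the
  relabelled c, which is again a short cycle.\<close>

lemma gray_code_relabel_list:
  assumes F: "distinct F" and L: "gray_code {1..length F} L"
  shows "gray_code (set F) (relabel_list F L)"
proof -
  let ?N = "{1..length F}" and ?f = "word_fun F"
  have f: "bij_betw ?f ?N (set F)" using F by (rule bij_betw_word_fun)
  have relabel: "relabel F = map_permutation ?N ?f"
    using relabel_eq_map_permutation[OF F] by blast
  have bij: "bij_betw (relabel F) (involutions ?N) (involutions (set F))"
    unfolding relabel using f by (rule bij_betw_map_permutation_involutions)
  have step: "gray_on (set F) (relabel F u) (relabel F v)" if uv: "gray_on ?N u v" for u v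
  proof -
    obtain c where c: "short_cycle ?N c" "v = u \<circ> c"
      using uv unfolding gray_on_def by blast
    have inj: "inj_on ?f ?N" and im: "?f ` ?N = set F" using f by (auto simp: bij_betw_def)
    have "relabel F v = relabel F u \<circ> relabel F c"
      unfolding relabel c(2) by (rule map_permutation_compose'[OF inj short_cycle_permutes[OF c(1)]])
    moreover have "short_cycle (set F) (relabel F c)"
      using short_cycle_map_permutation[OF c(1) inj] unfolding relabel im .
    ultimately show ?thesis unfolding gray_on_def by blast
  qed
  have "successively (\<lambda>u v. gray_on (set F) (relabel F u) (relabel F v)) L"
    using L step unfolding gray_code_def by (blast intro: successively_mono)
  then show ?thesis
    using L bij unfolding gray_code_def relabel_list_def
    by (auto simp: distinct_map bij_betw_def successively_map)
qed

lemma relabel_id: "distinct F \<Longrightarrow> relabel F id = id"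
  using bij_betw_word_fun
  by (auto simp: relabel_eq_map_permutation bij_betw_def intro!: map_permutation_id')

lemma relabel_transpose:
  assumes "distinct F" "i \<in> {1..length F}" "j \<in> {1..length F}"
  shows "relabel F (transpose i j) = transpose (F ! (i - 1)) (F ! (j - 1))"
  using map_permutation_transpose[OF bij_betw_imp_inj_on[OF bij_betw_word_fun[OF assms(1)]] assms(2,3)]
  by (simp add: relabel_eq_map_permutation assms(1) word_fun_def)

section \<open>Classes of involutions with a prescribed value at one letter\<close>

lemma append_fixed_gray_code:
  assumes "gray_code N L" "k \<notin> N"
  shows "append_fixed k L = L"
  unfolding append_fixed_def
proof (rule map_idI)
  fix w assume "w \<in> set L"
  then have "w k = k" using assms by (auto simp: gray_code_def involutions_def permutes_not_in)
  then show "w(k := k) = w" by auto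
qed

lemma involutions_fixing:
  assumes "k \<notin> N"
  shows "{w \<in> involutions (insert k N). w k = k} = involutions N"
  using assms unfolding involutions_def
  by (auto simp: permutes_not_in intro: permutes_superset permutes_subset)

text \<open>An involution taking k to i contains the 2-cycle (i k). Multiplication by (i k) strips
  or restores this cycle and is its own inverse.\<close>

lemma involutions_swapping:
  assumes "i \<notin> N" "k \<notin> N" "i \<noteq> k"
  shows "(\<lambda>w. w \<circ> transpose i k) ` involutions N =
    {w \<in> involutions (insert i (insert k N)). w k = i}"
proof (intro equalityI subsetI)
  fix v assume "v \<in> (\<lambda>w. w \<circ> transpose i k) ` involutions N"
  then obtain w where v: "v = w \<circ> transpose i k" and w: "w permutes N" "w \<circ> w = id"
    by (auto simp: involutions_def)
  have "v permutes insert i (insert k N)"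
    unfolding v using w(1) by (intro permutes_compose permutes_swap_id) (auto intro: permutes_subset)
  \<comment> \<open>Moving the inner transposition past w brings both copies of w, and both
    transpositions, together.\<close>
  moreover have "v \<circ> v = w \<circ> (transpose i k \<circ> w) \<circ> transpose i k"
    by (simp add: v comp_assoc)
  then have "v \<circ> v = id"
    unfolding permutes_commute_transpose[OF w(1) assms(1,2), symmetric]
    using w(2) by (simp add: fun_eq_iff)
  moreover have "v k = i" using w(1) assms(1) by (simp add: v permutes_not_in)
  ultimately show "v \<in> {w \<in> involutions (insert i (insert k N)). w k = i}"
    by (simp add: involutions_def)
next
  fix v assume "v \<in> {w \<in> involutions (insert i (insert k N)). w k = i}"
  then have v: "v permutes insert i (insert k N)" "v \<circ> v = id" and ki: "v k = i"
    by (auto simp: involutions_def)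
  have ik: "v i = k" using v(2) ki by (metis comp_apply id_apply)
  define w where "w = v \<circ> transpose i k"
  have "w permutes insert i (insert k N)"
    unfolding w_def using v(1) by (intro permutes_compose permutes_swap_id) auto
  moreover have "w i = i" "w k = k" using ki ik by (auto simp: w_def)
  ultimately have "w permutes N" by (auto intro: permutes_superset)
  moreover have "w \<circ> w = id"
  proof
    fix x
    have vv: "v (v y) = y" for y using v(2) by (metis comp_apply id_apply)
    \<comment> \<open>Since v exchanges i and k, it maps every other point outside {i, k}; there the
      transposition in w is invisible and w w agrees with v v.\<close>
    have "v x \<noteq> i" if "x \<noteq> k" using that vv[of x] ik by auto
    moreover have "v x \<noteq> k" if "x \<noteq> i" using that vv[of x] ki by auto
    ultimately show "(w \<circ> w) x = id x"
      using vv ki ik by (auto simp: w_def transpose_def)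
  qed
  ultimately have "w \<in> involutions N" by (simp add: involutions_def)
  moreover have "v = w \<circ> transpose i k" by (simp add: w_def comp_assoc)
  ultimately show "v \<in> (\<lambda>w. w \<circ> transpose i k) ` involutions N" by blast
qed

lemma append_swap_gray_code:
  assumes "gray_code N L" "i \<notin> N" "k \<notin> N" "i \<noteq> k"
  shows "distinct (append_swap i k L)"
    and "set (append_swap i k L) = {w \<in> involutions (insert i (insert k N)). w k = i}"
    and "successively (gray_on N) (append_swap i k L)"
proof -
  have "inj (\<lambda>w :: nat \<Rightarrow> nat. w \<circ> transpose i k)"
    by (rule inj_on_inverseI[where g = "\<lambda>w. w \<circ> transpose i k"]) (simp add: comp_assoc)
  then show "distinct (append_swap i k L)"
    using assms(1) by (auto simp: append_swap_def gray_code_def distinct_map intro: inj_on_subset)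
  show "set (append_swap i k L) = {w \<in> involutions (insert i (insert k N)). w k = i}"
    using assms(1) involutions_swapping[OF assms(2-4)] by (simp add: append_swap_def gray_code_def)
  show "successively (gray_on N) (append_swap i k L)"
    using assms gray_on_comp_disjoint_transpose
    by (auto simp: append_swap_def gray_code_def successively_map elim!: successively_mono)
qed

section \<open>Concatenation of blocks\<close>

text \<open>The induction carries \<open>hd\<close> and \<open>last\<close> along: the new seam lies
  between the last element of the concatenation so far, which is that of \<open>B m\<close>, and the
  head of the next block.\<close>

lemma concat_blocks:
  fixes B :: "nat \<Rightarrow> 'a list"
  assumes "\<And>j. j \<le> m \<Longrightarrow> B j \<noteq> []"
    and "\<And>j. j \<le> m \<Longrightarrow> distinct (B j)"
    and "\<And>j. j \<le> m \<Longrightarrow> successively P (B j)"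
    and "\<And>j. j < m \<Longrightarrow> P (last (B j)) (hd (B (Suc j)))"
    and "\<And>i j. i < j \<Longrightarrow> j \<le> m \<Longrightarrow> set (B i) \<inter> set (B j) = {}"
  shows "distinct (concat (map B [0..<Suc m])) \<and> successively P (concat (map B [0..<Suc m])) \<and>
    hd (concat (map B [0..<Suc m])) = hd (B 0) \<and> last (concat (map B [0..<Suc m])) = last (B m)"
  using assms
proof (induction m)
  case 0
  then show ?case by simp
next
  case (Suc m)
  let ?C = "concat (map B [0..<Suc m])"
  have IH: "distinct ?C \<and> successively P ?C \<and> hd ?C = hd (B 0) \<and> last ?C = last (B m)"
    by (rule Suc.IH) (use Suc.prems in auto)
  have split: "concat (map B [0..<Suc (Suc m)]) = ?C @ B (Suc m)" by simp
  have "set ?C \<inter> set (B (Suc m)) = {}" using Suc.prems(5)[of _ "Suc m"]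
    by (auto simp del: upt_Suc simp: disjoint_iff)
  moreover have "?C \<noteq> []" using Suc.prems(1) by auto
  ultimately show ?case
    unfolding split using IH Suc.prems(1-4)[of "Suc m"] Suc.prems(4)[of m]
    by (simp del: upt_Suc add: successively_append_iff)
qed

text \<open>The recursion emits two blocks per index i; this flattens them to one index range. The
  offset a absorbs the parity of n: 1 for odd n, 0 for even n.\<close>

lemma concat_map_pairs:
  "concat (map (\<lambda>i. f (2 * i + a) @ f (2 * i + Suc a)) [m..<k]) =
    concat (map f [2 * m + a..<2 * k + a])"
proof (cases "m \<le> k")
  case True
  then show ?thesis
  proof (induction k rule: dec_induct)
    case base
    then show ?case by simp
  next
    case (step k)
    have "[2 * m + a..<2 * Suc k + a] = [2 * m + a..<2 * k + a] @ [2 * k + a, 2 * k + Suc a]"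
      using step.hyps by (simp add: upt_rec[of "2 * k + a"])
    then show ?case using step by simp
  qed
qed simp

section \<open>The blocks of the recursion\<close>

text \<open>If n and j have the same parity, the block for w n = j relabels by the word G of the pair
  j, j + 1; otherwise it is reversed and relabels by the word H of the pair j - 1, j. For j = 1
  in the second case, H has no first letter.\<close>

definition block_word :: "nat \<Rightarrow> nat \<Rightarrow> nat list" where
  "block_word n j = (if even (n + j) then [j + 1] @ [1..<j] @ [j + 2..<n]
     else (if j = 1 then [] else [j - 1]) @ [1..<j - 1] @ [j + 1..<n])"

text \<open>Index 0 stands for the class w n = n, which comes first in the list; thus the blocks are
  numbered 0 to n - 1 in order.\<close>

definition block :: "nat \<Rightarrow> nat \<Rightarrow> (nat \<Rightarrow> nat) list" where
  "block n j = (if j = 0 then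
      append_fixed n (if even n then GCA (n - 1) else relabel_list ([2..<n] @ [1]) (GCA (n - 1)))
    else append_swap j n ((if even (n + j) then id else rev)
      (relabel_list (block_word n j) (GCA (n - 2)))))"

lemma GCA_eq_concat_block:
  assumes "n \<ge> 5"
  shows "GCA n = concat (map (block n) [0..<n])"
proof (cases "even n")
  case False
  let ?f = "\<lambda>i. append_swap (2*i - 1) n
             (relabel_list ([2*i] @ [1..<2*i - 1] @ [2*i + 1..<n]) (GCA (n - 2))) @
           append_swap (2*i) n
             (rev (relabel_list ([2*i - 1] @ [1..<2*i - 1] @ [2*i + 1..<n]) (GCA (n - 2))))"
  \<comment> \<open>Starting i at 0 instead of 1 replaces the indices 2 i - 1 and 2 i by 2 i + 1 and
    2 i + 2, free of truncated subtraction.\<close>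
  have "block n (2 * i + 1) @ block n (2 * i + Suc 1) = ?f (Suc i)" for i
    using False by (simp add: block_def block_word_def)
  then have "concat (map ?f (map Suc [0..<(n - 1) div 2])) =
      concat (map (\<lambda>i. block n (2 * i + 1) @ block n (2 * i + Suc 1)) [0..<(n - 1) div 2])"
    unfolding map_map comp_def by (intro arg_cong[where f = concat] map_cong) simp_all
  also have "\<dots> = concat (map (block n) [2 * 0 + 1..<2 * ((n - 1) div 2) + 1])"
    by (rule concat_map_pairs)
  also have "2 * ((n - 1) div 2) + 1 = n" using False assms by presburger
  finally have "concat (map ?f [1..<(n - 1) div 2 + 1]) = concat (map (block n) [1..<n])"
    unfolding map_Suc_upt by simp
  moreover have "[0..<n] = 0 # [1..<n]" using assms by (simp add: upt_rec[of 0])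
  ultimately show ?thesis
    using assms False by (subst GCA.simps) (simp add: block_def)
next
  case True
  let ?f = "\<lambda>i. append_swap (2*i) n
             (relabel_list ([2*i + 1] @ [1..<2*i] @ [2*i + 2..<n]) (GCA (n - 2))) @
           append_swap (2*i + 1) n
             (rev (relabel_list ([2*i] @ [1..<2*i] @ [2*i + 2..<n]) (GCA (n - 2))))"
  have "concat (map ?f [1..<n div 2]) =
      concat (map (\<lambda>i. block n (2 * i + 0) @ block n (2 * i + Suc 0)) [1..<n div 2])"
    using True by (intro arg_cong[where f = concat] map_cong) (auto simp: block_def block_word_def)
  also have "\<dots> = concat (map (block n) [2 * 1 + 0..<2 * (n div 2) + 0])"
    by (rule concat_map_pairs)
  also have "2 * (n div 2) + 0 = n" using True by presburger
  finally have "concat (map ?f [1..<n div 2]) = concat (map (block n) [2..<n])"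
    by simp
  moreover have "[0..<n] = 0 # 1 # [2..<n]"
    using assms by (simp add: upt_conv_Cons numeral_2_eq_2)
  \<comment> \<open>For even n the pairs start at 2, so the block for 1 stands alone.\<close>
  moreover have "block_word n 1 = [1 + 1..<n]"
    using True by (simp add: block_word_def)
  then have "block n 0 = append_fixed n (GCA (n - 1))"
    "block n 1 = append_swap 1 n (rev (relabel_list [2..<n] (GCA (n - 2))))"
    using True unfolding one_add_one by (simp_all add: block_def)
  ultimately show ?thesis
    using assms True by (subst GCA.simps) simp
qed

lemma block_word:
  assumes "1 \<le> j" "j < n"
  shows "distinct (block_word n j)" and "set (block_word n j) = {1..n - 1} - {j}"
    and "length (block_word n j) = n - 2"
proof -
  \<comment> \<open>Parity excludes j = n - 1, so the first letter j + 1 of the word lies in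
    [n - 1].\<close>
  have up: "j + 1 < n" if "even (n + j)"
    using that assms by (metis Suc_eq_plus1 Suc_lessI even_add even_Suc)
  show distinct: "distinct (block_word n j)"
    using assms by (auto simp: block_word_def)
  show set: "set (block_word n j) = {1..n - 1} - {j}"
    using assms up by (auto simp: block_word_def)
  show "length (block_word n j) = n - 2"
    using distinct_card[OF distinct] assms unfolding set by simp
qed

text \<open>This is where n \<open>\<ge>\<close> 5 is needed: the words of the two blocks differ in the first letter
  only, and GCA (n - 2) ends with a transposition of two of the remaining at least two letters.\<close>

lemma relabel_block_word_Suc:
  assumes "n \<ge> 5" "1 \<le> j" "Suc j < n" "even (n + j)"
  shows "relabel (block_word n (Suc j)) (transpose (n - 3) (n - 2)) =
    relabel (block_word n j) (transpose (n - 3) (n - 2))"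
proof -
  have words: "block_word n j = (j + 1) # [1..<j] @ [j + 2..<n]"
    "block_word n (Suc j) = j # [1..<j] @ [j + 2..<n]"
    using assms by (auto simp: block_word_def)
  have nth: "block_word n (Suc j) ! (i - 1) = block_word n j ! (i - 1)" if "2 \<le> i" for i
    using that by (auto simp: words nth_Cons split: nat.split)
  have relabel: "relabel (block_word n k) (transpose (n - 3) (n - 2)) =
      transpose (block_word n k ! (n - 3 - 1)) (block_word n k ! (n - 2 - 1))"
    if "1 \<le> k" "k < n" for k
    by (rule relabel_transpose) (use block_word(1,3)[OF that] assms(1) in auto)
  have "2 \<le> n - 3" "2 \<le> n - 2" using assms(1) by simp_all
  then show ?thesis
    using relabel[of j] relabel[of "Suc j"] nth[of "n - 3"] nth[of "n - 2"] assms(2,3) by simp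
qed

section \<open>The recursion step: ends of the blocks, seams, assembly\<close>

context
  fixes n :: nat
  assumes n: "n \<ge> 5"
    and code1: "gray_code {1..n - 1} (GCA (n - 1))" and A1_1: "property_A1 (n - 1) (GCA (n - 1))"
    and code2: "gray_code {1..n - 2} (GCA (n - 2))" and A1_2: "property_A1 (n - 2) (GCA (n - 2))"
begin

text \<open>For odd n the rotated word carries the final transposition (n - 2 n - 1) to (n - 1 1).
  It then shares the letter 1 with (1 n), the head of block 1.\<close>

lemma block_0:
  "gray_code {1..n - 1} (block n 0)" "hd (block n 0) = id" "block n 0 \<noteq> []"
  "last (block n 0) = (if even n then transpose (n - 2) (n - 1) else transpose 1 (n - 1))"
proof -
  let ?F = "[2..<n] @ [1]"
  have F: "distinct ?F" "set ?F = {1..n - 1}" "length ?F = n - 1" using n by auto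
  have rcode: "gray_code {1..n - 1} (relabel_list ?F (GCA (n - 1)))"
    using gray_code_relabel_list[OF F(1)] code1 unfolding F(2,3) by blast
  have eq: "block n 0 = (if even n then GCA (n - 1) else relabel_list ?F (GCA (n - 1)))"
    using append_fixed_gray_code[OF code1] append_fixed_gray_code[OF rcode] n
    by (simp add: block_def)
  show "gray_code {1..n - 1} (block n 0)" unfolding eq using code1 rcode by simp
  show "hd (block n 0) = id" "block n 0 \<noteq> []"
    unfolding eq using A1_1 relabel_id[OF F(1)]
    by (auto simp: property_A1_def relabel_list_def hd_map)
  have "n - 1 - 1 = n - 2" by simp
  moreover have "relabel ?F (transpose (n - 2) (n - 1)) = transpose 1 (n - 1)"
  proof -
    have "relabel ?F (transpose (n - 2) (n - 1)) = transpose (?F ! (n - 2 - 1)) (?F ! (n - 1 - 1))"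
      using F(1) by (rule relabel_transpose) (use F(3) n in auto)
    moreover have "?F ! (n - 2 - 1) = n - 1" "?F ! (n - 1 - 1) = 1"
      using n by (auto simp: nth_append)
    ultimately show ?thesis by (simp add: transpose_commute)
  qed
  ultimately show
    "last (block n 0) = (if even n then transpose (n - 2) (n - 1) else transpose 1 (n - 1))"
    unfolding eq using A1_1 by (simp add: property_A1_def relabel_list_def last_map)
qed

text \<open>\<open>GCA (n - 2)\<close> runs from the identity to (n - 3 n - 2). Relabelling fixes
  the identity, reversal exchanges the two ends, and every element receives the factor (j
  n).\<close>

lemma block_pos:
  assumes "1 \<le> j" "j < n"
  shows "distinct (block n j)" "set (block n j) = {w \<in> involutions {1..n}. w n = j}"
    "successively (gray_on {1..n}) (block n j)" "block n j \<noteq> []"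
    "hd (block n j) = (if even (n + j) then id
      else relabel (block_word n j) (transpose (n - 3) (n - 2))) \<circ> transpose j n"
    "last (block n j) = (if even (n + j) then relabel (block_word n j) (transpose (n - 3) (n - 2))
      else id) \<circ> transpose j n"
proof -
  let ?N = "{1..n - 1} - {j}" and ?R = "relabel_list (block_word n j) (GCA (n - 2))"
  note word = block_word[OF assms]
  have "gray_code ?N ?R"
    using gray_code_relabel_list[OF word(1)] code2 unfolding word(2,3) by blast
  then have code: "gray_code ?N ((if even (n + j) then id else rev) ?R)"
    using gray_code_rev by simp
  have eq: "block n j = append_swap j n ((if even (n + j) then id else rev) ?R)"
    using assms by (simp add: block_def)
  have not_in: "j \<notin> ?N" "n \<notin> ?N" "j \<noteq> n" using assms by auto
  have ins: "insert j (insert n ?N) = {1..n}" using assms by auto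
  note swap = append_swap_gray_code[OF code not_in, folded eq, unfolded ins]
  show "distinct (block n j)" "set (block n j) = {w \<in> involutions {1..n}. w n = j}"
    using swap(1,2) by blast+
  have "?N \<subseteq> {1..n}" by auto
  then show "successively (gray_on {1..n}) (block n j)"
    using successively_mono[OF swap(3)] gray_on_mono by blast
  have n3: "n - 2 - 1 = n - 3" by simp
  show "block n j \<noteq> []"
    "hd (block n j) = (if even (n + j) then id
      else relabel (block_word n j) (transpose (n - 3) (n - 2))) \<circ> transpose j n"
    "last (block n j) = (if even (n + j) then relabel (block_word n j) (transpose (n - 3) (n - 2))
      else id) \<circ> transpose j n"
    using A1_2 relabel_id[OF word(1)] unfolding eq property_A1_def n3
    by (auto simp: append_swap_def relabel_list_def hd_map last_map hd_rev last_rev)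
qed

lemma gray_on_block_boundary:
  assumes "j < n - 1"
  shows "gray_on {1..n} (last (block n j)) (hd (block n (Suc j)))"
proof (cases "j = 0")
  case True
  have hd: "hd (block n 1) = (if odd n then id
      else relabel (block_word n 1) (transpose (n - 3) (n - 2))) \<circ> transpose 1 n"
    using block_pos(5)[of 1] n by auto
  show ?thesis
  proof (cases "even n")
    case even: True
    have "relabel (block_word n 1) (transpose (n - 3) (n - 2)) =
        transpose (block_word n 1 ! (n - 3 - 1)) (block_word n 1 ! (n - 2 - 1))"
      by (rule relabel_transpose) (use n block_word(1,3)[of 1 n] in auto)
    also have "\<dots> = transpose (n - 2) (n - 1)"
    proof -
      have "block_word n 1 ! (n - 3 - 1) = n - 2" "block_word n 1 ! (n - 2 - 1) = n - 1"
        using n even by (auto simp: block_word_def)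
      then show ?thesis by simp
    qed
    \<comment> \<open>Block 0 ends with (n - 2 n - 1) and block 1 starts with (n - 2 n - 1)(1 n), so
      a single transposition suffices.\<close>
    finally show ?thesis
      using True even n hd block_0(4) gray_on_comp_transpose[of 1 "{1..n}" n] by simp
  next
    case False
    \<comment> \<open>Here the letter kept is 1, and its partner changes from n - 1 to n.\<close>
    have "gray_on {1..n} (id \<circ> transpose (n - 1) 1) (id \<circ> transpose n 1)"
      using n by (intro gray_on_exchange_partner) auto
    then show ?thesis
      using True False hd block_0(4) by (simp add: transpose_commute)
  qed
next
  case False
  then have j: "1 \<le> j" "Suc j < n" using assms by auto
  \<comment> \<open>The factor common to both sides of the seam. For n + j even, the next block is
    reversed and starts with the same relabelled transposition; for n + j odd, a reversed block ends
    and a forward one begins, both at the identity.\<close>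
  define u where
    "u = (if even (n + j) then relabel (block_word n j) (transpose (n - 3) (n - 2)) else id)"
  have "last (block n j) = u \<circ> transpose j n"
    using block_pos(6)[of j] j by (simp add: u_def)
  moreover have "hd (block n (Suc j)) = u \<circ> transpose (Suc j) n"
    using block_pos(5)[of "Suc j"] j relabel_block_word_Suc[OF n j] by (simp add: u_def)
  ultimately show ?thesis
    using gray_on_exchange_partner[of j "{1..n}" "Suc j" n] j by simp
qed

lemma GCA_step:
  "gray_code {1..n} (GCA n) \<and> property_A1 n (GCA n) \<and> cyclic_list n (GCA n)"
proof -
  have N: "{1..n} = insert n {1..n - 1}" using n by auto
  have set0: "set (block n 0) = {w \<in> involutions {1..n}. w n = n}"
    using block_0(1) involutions_fixing[of n "{1..n - 1}"] n unfolding N gray_code_def by simp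
  \<comment> \<open>The value at n determines the block, which gives both disjointness and, below,
    exhaustion.\<close>
  have set: "set (block n j) = {w \<in> involutions {1..n}. w n = (if j = 0 then n else j)}"
    if "j < n" for j
    using set0 block_pos(2)[of j] that by simp
  have G: "GCA n = concat (map (block n) [0..<Suc (n - 1)])"
    using GCA_eq_concat_block[OF n] n by simp
  have succ0: "successively (gray_on {1..n}) (block n 0)"
    using block_0(1) gray_on_mono[of "{1..n - 1}" _ _ "{1..n}"]
    unfolding gray_code_def by (auto elim!: successively_mono)
  have main: "distinct (GCA n) \<and> successively (gray_on {1..n}) (GCA n) \<and>
      hd (GCA n) = hd (block n 0) \<and> last (GCA n) = last (block n (n - 1))"
    unfolding G
  proof (rule concat_blocks)
    fix j assume j: "j \<le> n - 1"
    show "block n j \<noteq> []" "distinct (block n j)" "successively (gray_on {1..n}) (block n j)"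
      using block_0(1,3) succ0 block_pos(1,3,4)[of j] j n unfolding gray_code_def
      by (cases "j = 0"; simp)+
  next
    fix j assume "j < n - 1"
    then show "gray_on {1..n} (last (block n j)) (hd (block n (Suc j)))"
      by (rule gray_on_block_boundary)
  next
    fix i j assume "i < j" "j \<le> n - 1"
    then show "set (block n i) \<inter> set (block n j) = {}"
      using set[of i] set[of j] n by auto
  qed
  have "involutions {1..n} \<subseteq> (\<Union>j<n. set (block n j))"
  proof
    fix w assume w: "w \<in> involutions {1..n}"
    then have "w n \<in> {1..n}"
      using n permutes_in_image[of w "{1..n}" n] by (auto simp: involutions_def)
    then have "w \<in> set (block n (if w n = n then 0 else w n))" "(if w n = n then 0 else w n) < n"
      using w set n by auto
    then show "w \<in> (\<Union>j<n. set (block n j))" by blast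
  qed
  then have "set (GCA n) = involutions {1..n}"
    using set unfolding GCA_eq_concat_block[OF n] by (auto simp: lessThan_atLeast0)
  then have "gray_code {1..n} (GCA n)" using main by (simp add: gray_code_def)
  \<comment> \<open>The sum n + (n - 1) is odd, so the final block is reversed and ends with the
    identity times (n - 1 n).\<close>
  moreover have last: "last (GCA n) = transpose (n - 1) n" and hd: "hd (GCA n) = id"
    using main block_pos(6)[of "n - 1"] block_0(2) n by auto
  moreover have "GCA n \<noteq> []"
    unfolding G using block_0(3) by (auto simp del: upt_Suc)
  \<comment> \<open>Closing the cycle: multiplying the last element by itself returns to the
    identity.\<close>
  moreover have "gray_on {1..n} (transpose (n - 1) n) (transpose (n - 1) n \<circ> transpose (n - 1) n)"
    using n by (intro gray_on_comp_transpose) auto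
  ultimately show ?thesis
    by (simp add: property_A1_def cyclic_list_def gray_step_iff_gray_on)
qed

end

theorem theorem3p2:
  fixes n :: nat
  assumes "n \<ge> 5"
    and "lists_involutions_once (n - 2) (GCA (n - 2))"
    and "property_A1 (n - 2) (GCA (n - 2))"
    and "property_A2 (n - 2) (GCA (n - 2))"
    and "lists_involutions_once (n - 1) (GCA (n - 1))"
    and "property_A1 (n - 1) (GCA (n - 1))"
    and "property_A2 (n - 1) (GCA (n - 1))"
  shows "lists_involutions_once n (GCA n) \<and> property_A1 n (GCA n) \<and> property_A2 n (GCA n) \<and>
         cyclic_list n (GCA n)"
  using GCA_step[OF assms(1)] assms(2-) unfolding gray_code_atLeastAtMost_iff by blast

end
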